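(* Let $m > d \geq 1$ be integers, let $F_1, \dots, F_{d+1}$ be finite families of compact convex sets in $\mathbb{R}^m$, and let $Y$ be a locally finite $d$-dimensional simplicial complex. If $C_1\cap \cdots \cap C_{d+1}\neq\emptyset$ for every choice $C_1\in F_1, \dots, C_{d+1}\in F_{d+1}$, then for every continuous map $f \colon \mathbb{R}^m \to \|Y\|$ there exist a point $y\in \|Y\|$ and an index $i \in \{1,\dots,d+1\}$ such that $f^{-1}(y)$ intersects every member of $F_i$.
   Context: For a (locally finite) simplicial complex $Y$, $\|Y\|$ denotes its polyhedron: the underlying topological space, i.e. the union of its simplices with the topology induced by the geometric realization. *)

theory Defs
  imports "HOL-Analysis.Analysis"
begin

text \<open>
  Simplicial complexes are abstract ones: a simplex is the finite nonempty set of its vertices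
  (the empty set is not counted as a simplex), and the vertex set of \<open>K\<close> is \<open>\<Union>K\<close>, which need not
  be all of the vertex type.
\<close>

definition abstract_simplicial_complex :: "'v set set \<Rightarrow> bool" where
  "abstract_simplicial_complex K \<longleftrightarrow>
     (\<forall>\<sigma>\<in>K. finite \<sigma> \<and> \<sigma> \<noteq> {}) \<and>
     (\<forall>\<sigma>\<in>K. \<forall>\<tau>. \<tau> \<noteq> {} \<and> \<tau> \<subseteq> \<sigma> \<longrightarrow> \<tau> \<in> K)"

definition locally_finite_complex :: "'v set set \<Rightarrow> bool" where
  "locally_finite_complex K \<longleftrightarrow> (\<forall>v\<in>\<Union>K. finite {\<sigma>\<in>K. v \<in> \<sigma>})"

definition has_dimension :: "'v set set \<Rightarrow> nat \<Rightarrow> bool" where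
  "has_dimension K d \<longleftrightarrow> (\<forall>\<sigma>\<in>K. card \<sigma> \<le> d + 1) \<and> (\<exists>\<sigma>\<in>K. card \<sigma> = d + 1)"

text \<open>
  A point of the geometric realization is given by its barycentric coordinates, a function on
  vertices.
\<close>

definition closed_simplex :: "'v set \<Rightarrow> ('v \<Rightarrow> real) set" where
  "closed_simplex \<sigma> = {x. (\<forall>v. 0 \<le> x v) \<and> (\<forall>v. v \<notin> \<sigma> \<longrightarrow> x v = 0) \<and> (\<Sum>v\<in>\<sigma>. x v) = 1}"

definition polyhedron_points :: "'v set set \<Rightarrow> ('v \<Rightarrow> real) set" where
  "polyhedron_points K = (\<Union>\<sigma>\<in>K. closed_simplex \<sigma>)"

text \<open>
  The polyhedron carries the topology coherent with its closed simplices. Each closed simplex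
  has the subspace topology of the product topology on \<open>'v \<Rightarrow> real\<close>, which is its Euclidean
  topology because only the finitely many coordinates in \<open>\<sigma>\<close> vary.
\<close>

definition polyhedron_space :: "'v set set \<Rightarrow> ('v \<Rightarrow> real) topology" where
  "polyhedron_space K = topology (\<lambda>U. U \<subseteq> polyhedron_points K \<and>
     (\<forall>\<sigma>\<in>K. openin (top_of_set (closed_simplex \<sigma>)) (U \<inter> closed_simplex \<sigma>)))"

lemma openin_polyhedron_space:
  "openin (polyhedron_space K) U \<longleftrightarrow> U \<subseteq> polyhedron_points K \<and>
     (\<forall>\<sigma>\<in>K. openin (top_of_set (closed_simplex \<sigma>)) (U \<inter> closed_simplex \<sigma>))"
proof -
  let ?L = "\<lambda>U. U \<subseteq> polyhedron_points K \<and>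
     (\<forall>\<sigma>\<in>K. openin (top_of_set (closed_simplex \<sigma>)) (U \<inter> closed_simplex \<sigma>))"
  have "istopology ?L"
    unfolding istopology_def
  proof (intro conjI allI impI)
    fix S T assume S: "?L S" and T: "?L T"
    show "S \<inter> T \<subseteq> polyhedron_points K" using S by blast
    show "\<forall>\<sigma>\<in>K. openin (top_of_set (closed_simplex \<sigma>)) (S \<inter> T \<inter> closed_simplex \<sigma>)"
    proof
      fix \<sigma> assume "\<sigma> \<in> K"
      then have "openin (top_of_set (closed_simplex \<sigma>))
          ((S \<inter> closed_simplex \<sigma>) \<inter> (T \<inter> closed_simplex \<sigma>))"
        using S T by (blast intro: openin_Int[where S = "S \<inter> closed_simplex \<sigma>"])
      moreover have "(S \<inter> closed_simplex \<sigma>) \<inter> (T \<inter> closed_simplex \<sigma>) = S \<inter> T \<inter> closed_simplex \<sigma>"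
        by blast
      ultimately show "openin (top_of_set (closed_simplex \<sigma>)) (S \<inter> T \<inter> closed_simplex \<sigma>)"
        by simp
    qed
  next
    fix \<K> assume \<K>: "\<forall>U\<in>\<K>. ?L U"
    show "\<Union>\<K> \<subseteq> polyhedron_points K" using \<K> by blast
    show "\<forall>\<sigma>\<in>K. openin (top_of_set (closed_simplex \<sigma>)) (\<Union>\<K> \<inter> closed_simplex \<sigma>)"
      unfolding Int_Union2 using \<K> by (blast intro: openin_Union)
  qed
  then show ?thesis
    unfolding polyhedron_space_def by (simp add: topology_inverse')
qed

lemma topspace_polyhedron_space [simp]:
  "topspace (polyhedron_space K) = polyhedron_points K"
proof (rule antisym)
  show "topspace (polyhedron_space K) \<subseteq> polyhedron_points K"
    using openin_topspace openin_polyhedron_space by blast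
  have "polyhedron_points K \<inter> closed_simplex \<sigma> = closed_simplex \<sigma>" if "\<sigma> \<in> K" for \<sigma>
    using that by (auto simp: polyhedron_points_def)
  then have "openin (polyhedron_space K) (polyhedron_points K)"
    by (simp add: openin_polyhedron_space)
  then show "polyhedron_points K \<subseteq> topspace (polyhedron_space K)"
    by (rule openin_subset)
qed

end

theory Submission
  imports Defs
begin

text \<open>
  If the theorem fails, then, by compactness, for each \<open>i\<close> every sufficiently small subset of the
  image of \<open>f\<close> misses \<open>f C\<close> for some \<open>C \<in> F i\<close>. Order the finitely many relevant vertices and
  take the partial sums \<open>s k\<close> of the barycentric coordinates; they determine the point. For the
  colour \<open>j \<in> {1..d+1}\<close> consider the points at which no \<open>N * s k\<close> is congruent to \<open>j / (d + 2)\<close>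
  modulo 1. Prescribing all the floors of \<open>N * s k - j / (d + 2)\<close> splits this set into disjoint open
  pieces, small for large \<open>N\<close>, so that each piece can be labelled by a member of \<open>F j\<close> which it
  misses. Since a point of a \<open>d\<close>-simplex has at most \<open>d\<close> partial sums other than 0 and 1, the
  \<open>d + 1\<close> colours cover everything.

  The labelled pieces give weights \<open>w j C\<close> on the convex hull \<open>S\<close> of all the sets. Send \<open>x\<close> to a
  convex combination of points of rainbow intersections, using only rainbow choices that contain
  every set of maximal weight at \<open>x\<close>. A Brouwer fixed point of this map lies in a set of positive
  weight at that point, although each set has weight zero on itself.
\<close>

section \<open>Brouwer's theorem applied to rainbow choices\<close>

text \<open>By \<open>unique\<close>, the sets of maximal (hence positive) weight at a point have
  pairwise different colours, so some rainbow choice contains all of them. Averaging the chosen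
  points over such choices only keeps the average inside each heaviest set, by convexity.\<close>

lemma colourful_fixed_point:
  fixes S :: "'a::euclidean_space set" and w :: "'i \<Rightarrow> 'a set \<Rightarrow> 'a \<Rightarrow> real"
  assumes S: "compact S" "convex S" "S \<noteq> {}"
    and I: "finite I" and F: "\<And>i. i \<in> I \<Longrightarrow> finite (F i)"
    and ne: "\<And>i. i \<in> I \<Longrightarrow> F i \<noteq> {}"
    and convF: "\<And>i C. i \<in> I \<Longrightarrow> C \<in> F i \<Longrightarrow> convex C"
    and rainbow: "\<And>c. c \<in> Pi\<^sub>E I F \<Longrightarrow> S \<inter> (\<Inter>i\<in>I. c i) \<noteq> {}"
    and cont: "\<And>i C. i \<in> I \<Longrightarrow> C \<in> F i \<Longrightarrow> continuous_on S (w i C)"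
    and nonneg: "\<And>i C x. i \<in> I \<Longrightarrow> C \<in> F i \<Longrightarrow> x \<in> S \<Longrightarrow> 0 \<le> w i C x"
    and unique: "\<And>i C C' x. i \<in> I \<Longrightarrow> C \<in> F i \<Longrightarrow> C' \<in> F i \<Longrightarrow> x \<in> S \<Longrightarrow>
                   0 < w i C x \<Longrightarrow> 0 < w i C' x \<Longrightarrow> C = C'"
    and pos: "\<And>x. x \<in> S \<Longrightarrow> \<exists>i\<in>I. \<exists>C\<in>F i. 0 < w i C x"
  shows "\<exists>x\<in>S. \<exists>i\<in>I. \<exists>C\<in>F i. 0 < w i C x \<and> x \<in> C"
proof -
  define P where "P = Sigma I F"
  \<comment> \<open>Choice functions are taken extensional so that there are finitely many of them
    to sum over.\<close>
  define R where "R = Pi\<^sub>E I F"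
  define W where "W = (\<lambda>q x. w (fst q) (snd q) x)"
  have finP: "finite P" and finR: "finite R"
    unfolding P_def R_def using I F by (auto intro: finite_PiE)
  have "\<exists>p. p \<in> S \<and> (\<forall>i\<in>I. p \<in> c i)" if "c \<in> R" for c
    using rainbow[of c] that unfolding R_def by auto
  then obtain p where p: "\<And>c. c \<in> R \<Longrightarrow> p c \<in> S" "\<And>c i. c \<in> R \<Longrightarrow> i \<in> I \<Longrightarrow> p c \<in> c i"
    by metis
  define M where "M = (\<lambda>x. Max ((\<lambda>q. W q x) ` P))"
  have W0: "0 \<le> W q x" if "q \<in> P" "x \<in> S" for q x
    using that nonneg unfolding P_def W_def by auto
  have Pne: "P \<noteq> {}"
    using S(3) pos unfolding P_def by blast
  have Mge: "W q x \<le> M x" if "q \<in> P" for q x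
    unfolding M_def using that finP by auto
  have Mattained: "\<exists>q\<in>P. W q x = M x" for x
  proof -
    have "M x \<in> (\<lambda>q. W q x) ` P" unfolding M_def using finP Pne by (intro Max_in) auto
    then show ?thesis by force
  qed
  have Mpos: "0 < M x" if x: "x \<in> S" for x
  proof -
    obtain i C where "i \<in> I" "C \<in> F i" "0 < w i C x" using pos[OF x] by blast
    then have "(i, C) \<in> P" "0 < W (i, C) x" by (auto simp: P_def W_def)
    then show ?thesis using Mge[of "(i, C)" x] by linarith
  qed
  have contW: "continuous_on S (W q)" if "q \<in> P" for q
    using that cont unfolding P_def W_def by auto
  have contM: "continuous_on S M"
    unfolding M_def
    using finP Pne contW
  proof (induction rule: finite_ne_induct)
    case (insert q Q)
    have "continuous_on S (\<lambda>x. max (W q x) (Max ((\<lambda>q. W q x) ` Q)))"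
      using insert by (intro continuous_on_max) auto
    then show ?case using insert by (simp add: Max_insert)
  qed auto
  text \<open>A choice \<open>c\<close> has positive weight at \<open>x\<close> only if it contains every heaviest set at \<open>x\<close>.\<close>
  define \<mu> where
    "\<mu> = (\<lambda>c x. \<Prod>q\<in>{q\<in>P. c (fst q) \<noteq> snd q}. (M x - W q x))"
  have \<mu>0: "0 \<le> \<mu> c x" for c x
    unfolding \<mu>_def using Mge by (intro prod_nonneg) auto
  have \<mu>cont: "continuous_on S (\<mu> c)" for c
    unfolding \<mu>_def using contM contW by (intro continuous_intros) auto
  have \<mu>ex: "\<exists>c\<in>R. 0 < \<mu> c x" if x: "x \<in> S" for x
  proof -
    \<comment> \<open>In each colour take the set of positive weight at \<open>x\<close>, if there
      is one, and any member otherwise. Every set not chosen then has weight 0, which is below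
      \<open>M x\<close>, so all factors of \<open>\<mu> c x\<close> are positive.\<close>
    define c where "c = (\<lambda>i\<in>I. if \<exists>C\<in>F i. 0 < w i C x then SOME C. C \<in> F i \<and> 0 < w i C x
                              else SOME C. C \<in> F i)"
    have c1: "c i \<in> F i \<and> (\<forall>C\<in>F i. 0 < w i C x \<longrightarrow> c i = C)" if i: "i \<in> I" for i
    proof (cases "\<exists>C\<in>F i. 0 < w i C x")
      case True
      then have "c i \<in> F i \<and> 0 < w i (c i) x"
        unfolding c_def using i someI_ex[of "\<lambda>C. C \<in> F i \<and> 0 < w i C x"] by auto
      then show ?thesis using unique i x by blast
    next
      case False
      then show ?thesis
        unfolding c_def using i ne[OF i] by (auto simp: some_in_eq)
    qed
    then have "c \<in> R" unfolding R_def c_def by auto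
    moreover have "0 < \<mu> c x"
      unfolding \<mu>_def
    proof (intro prod_pos ballI)
      fix q assume q: "q \<in> {q \<in> P. c (fst q) \<noteq> snd q}"
      then have "\<not> 0 < W q x" using c1 unfolding P_def W_def by auto
      then show "0 < M x - W q x" using Mpos[OF x] by linarith
    qed
    ultimately show ?thesis by blast
  qed
  define L where "L = (\<lambda>x. \<Sum>c\<in>R. \<mu> c x)"
  have Lpos: "0 < L x" if x: "x \<in> S" for x
  proof -
    obtain c where "c \<in> R" "0 < \<mu> c x" using \<mu>ex[OF x] by blast
    then show ?thesis unfolding L_def using \<mu>0 finR by (intro sum_pos2[of _ c]) auto
  qed
  define g where "g = (\<lambda>x. \<Sum>c\<in>R. (\<mu> c x / L x) *\<^sub>R p c)"
  \<comment> \<open>Stated for an arbitrary convex \<open>T\<close> because it serves twice: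
    \<open>T = S\<close> makes \<open>g\<close> a self-map, and \<open>T\<close> a heaviest set at
    the fixed point gives the conclusion.\<close>
  have gin: "g x \<in> T" if x: "x \<in> S" and T: "convex T" and pT: "\<And>c. c \<in> R \<Longrightarrow> 0 < \<mu> c x \<Longrightarrow> p c \<in> T" for x T
  proof -
    define Q where "Q = {c\<in>R. 0 < \<mu> c x}"
    have z: "\<mu> c x = 0" if "c \<in> R - Q" for c
      using that \<mu>0[of c x] unfolding Q_def by auto
    have "g x = (\<Sum>c\<in>Q. (\<mu> c x / L x) *\<^sub>R p c)"
      unfolding g_def using finR z by (intro sum.mono_neutral_right) (auto simp: Q_def)
    moreover have "L x = (\<Sum>c\<in>Q. \<mu> c x)"
      unfolding L_def using finR z by (intro sum.mono_neutral_right) (auto simp: Q_def)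
    then have "(\<Sum>c\<in>Q. \<mu> c x / L x) = 1"
      using Lpos[OF x] by (simp flip: sum_divide_distrib)
    then have "(\<Sum>c\<in>Q. (\<mu> c x / L x) *\<^sub>R p c) \<in> T"
      using finR T pT Lpos[OF x] by (intro convex_sum) (auto simp: Q_def)
    ultimately show ?thesis by simp
  qed
  have "continuous_on S g"
    unfolding g_def L_def using \<mu>cont Lpos
    by (intro continuous_intros) (auto simp: L_def less_imp_neq[symmetric] dest: Lpos)
  moreover have "g \<in> S \<rightarrow> S" using gin p(1) S(2) by auto
  ultimately obtain x where x: "x \<in> S" "g x = x"
    using brouwer[OF S] by blast
  obtain q where q: "q \<in> P" "W q x = M x" using Mattained by blast
  then have iC: "fst q \<in> I" "snd q \<in> F (fst q)" unfolding P_def by auto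
  have "g x \<in> snd q"
  proof (rule gin[OF x(1) convF[OF iC]])
    fix c assume c: "c \<in> R" "0 < \<mu> c x"
    have "c (fst q) = snd q"
    proof (rule ccontr)
      assume "c (fst q) \<noteq> snd q"
      then have "\<mu> c x = 0" unfolding \<mu>_def using finP q by (intro prod_zero bexI[of _ q]) simp_all
      then show False using c by simp
    qed
    then show "p c \<in> snd q" using p(2)[OF c(1) iC(1)] by simp
  qed
  moreover have "0 < w (fst q) (snd q) x" using q(2) Mpos[OF x(1)] by (simp add: W_def)
  ultimately show ?thesis using x iC by metis
qed

section \<open>Tools: gluing of weights, residues of partial sums, compactness\<close>

text \<open>Where \<open>u\<close> vanishes, the cut-off function is squeezed by the absolute value
  of \<open>u\<close>; elsewhere \<open>P\<close> does not jump. This makes the weights continuous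
  although the labels of the pieces change abruptly.\<close>

lemma continuous_on_if_locally_constant:
  fixes u :: "'a::t2_space \<Rightarrow> real"
  assumes u: "continuous_on S u"
    and loc: "\<And>x. x \<in> S \<Longrightarrow> u x \<noteq> 0 \<Longrightarrow> eventually (\<lambda>z. P z = P x) (at x within S)"
  shows "continuous_on S (\<lambda>x. if P x then u x else 0)"
  unfolding continuous_on_def
proof
  fix x assume x: "x \<in> S"
  have lim: "(u \<longlongrightarrow> u x) (at x within S)" using u x by (simp add: continuous_on_def)
  show "((\<lambda>x. if P x then u x else 0) \<longlongrightarrow> (if P x then u x else 0)) (at x within S)"
  proof (cases "u x = 0")
    case True
    then have "((\<lambda>x. if P x then u x else 0) \<longlongrightarrow> 0) (at x within S)"
      using tendsto_rabs[OF lim]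
      by (intro Lim_null_comparison[where g = "\<lambda>x. \<bar>u x\<bar>" and f = "\<lambda>x. if P x then u x else 0"]) simp_all
    then show ?thesis using True by simp
  next
    case False
    have "((\<lambda>z. if P x then u z else 0) \<longlongrightarrow> (if P x then u x else 0)) (at x within S)"
      using lim by simp
    then show ?thesis
    proof (rule Lim_transform_eventually)
      show "\<forall>\<^sub>F z in at x within S. (if P x then u z else 0) = (if P z then u z else 0)"
        by (rule eventually_mono[OF loc[OF x False]]) simp
    qed
  qed
qed

text \<open>Pigeonhole: if every colour \<open>j\<close> were hit, the partial sums hitting them
  would be \<open>d + 1\<close> distinct values other than 0 and 1. But a new partial sum arises
  only after a nonzero term, and one of these at most \<open>d + 1\<close> new values is the total
  1.\<close>

lemma partial_sums_avoid_residue: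
  fixes a :: "nat \<Rightarrow> real" and N :: nat
  assumes sum1: "(\<Sum>k<n. a k) = 1" and supp: "card {k. k < n \<and> a k \<noteq> 0} \<le> d + 1"
  shows "\<exists>j\<in>{1..d+1}. \<forall>k\<le>n. N * (\<Sum>l<k. a l) - real j / (real d + 2) \<notin> \<int>"
proof (rule ccontr)
  define s where "s = (\<lambda>k. \<Sum>l<k. a l)"
  define T where "T = {k. k < n \<and> a k \<noteq> 0}"
  assume "\<not> ?thesis"
  then have "\<forall>j\<in>{1..d+1}. \<exists>k. k \<le> n \<and> N * s k - real j / (real d + 2) \<in> \<int>"
    unfolding s_def by simp
  then obtain \<kappa> where \<kappa>: "\<And>j. j \<in> {1..d+1} \<Longrightarrow> \<kappa> j \<le> n \<and> N * s (\<kappa> j) - real j / (real d + 2) \<in> \<int>"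
    by metis
  \<comment> \<open>The \<open>d + 2\<close> residues with numerators 0 to \<open>d + 1\<close> are
    distinct modulo 1. Numerator 0 is reserved for the partial sums 0 and 1, which is why the
    denominator is not \<open>d + 1\<close>.\<close>
  have small: "i = j" if ij: "real i / (real d + 2) - real j / (real d + 2) \<in> \<int>" "i < d + 2" "j < d + 2" for i j
  proof -
    obtain z :: int where "real i / (real d + 2) - real j / (real d + 2) = z"
      using ij(1) by (rule Ints_cases)
    then have "(real i - real j) / (real d + 2) = z" by (simp add: diff_divide_distrib)
    then have "real i - real j = z * (real d + 2)" by (simp add: divide_eq_eq)
    then have "real_of_int (int i - int j) = real_of_int (z * int (d + 2))" by simp
    then have z: "int i - int j = z * int (d + 2)" by (simp only: of_int_eq_iff)
    have "\<bar>int i - int j\<bar> < int (d + 2)" using that by auto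
    then have "\<bar>z\<bar> * int (d + 2) < 1 * int (d + 2)" unfolding z by (simp add: abs_mult)
    then have "z = 0" by (simp only: mult_less_cancel_right) auto
    then show ?thesis using z by simp
  qed
  have range: "s k \<in> insert 0 ((\<lambda>k. s (Suc k)) ` T)" if "k \<le> n" for k
    using that
  proof (induction k)
    case (Suc k)
    show ?case
    proof (cases "a k = 0")
      case True
      then show ?thesis using Suc by (simp add: s_def)
    next
      case False
      then have "k \<in> T" using Suc by (auto simp: T_def)
      then show ?thesis by blast
    qed
  qed (simp add: s_def)
  have inj: "inj_on (\<lambda>j. s (\<kappa> j)) {1..d+1}"
  proof (rule inj_onI)
    fix i j assume ij: "i \<in> {1..d+1}" "j \<in> {1..d+1}" "s (\<kappa> i) = s (\<kappa> j)"
    have "(N * s (\<kappa> j) - real j / (real d + 2)) - (N * s (\<kappa> i) - real i / (real d + 2)) \<in> \<int>"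
      using \<kappa>[OF ij(1)] \<kappa>[OF ij(2)] by (blast intro: Ints_diff)
    then have "real i / (real d + 2) - real j / (real d + 2) \<in> \<int>" using ij(3) by simp
    then show "i = j" using small ij by auto
  qed
  have nonint: "s (\<kappa> j) \<noteq> 0 \<and> s (\<kappa> j) \<noteq> 1" if j: "j \<in> {1..d+1}" for j
  proof -
    \<comment> \<open>Since \<open>N\<close> is a natural number, an integral partial sum would make
      the residue of \<open>j\<close> equal to that of 0.\<close>
    have False if "s (\<kappa> j) \<in> \<int>"
    proof -
      have "N * s (\<kappa> j) - (N * s (\<kappa> j) - real j / (real d + 2)) \<in> \<int>"
        using Ints_diff[OF Ints_mult[OF Ints_of_nat that]] \<kappa>[OF j] by blast
      then have "real j / (real d + 2) - real 0 / (real d + 2) \<in> \<int>" by simp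
      then show False using small[of j 0] j by auto
    qed
    then show ?thesis by force
  qed
  have fT: "finite T" by (simp add: T_def)
  have "(\<lambda>j. s (\<kappa> j)) ` {1..d+1} \<subseteq> (\<lambda>k. s (Suc k)) ` T - {1}"
  proof (rule image_subsetI)
    fix j assume j: "j \<in> {1..d+1}"
    then have "\<kappa> j \<le> n" using \<kappa> by blast
    then show "s (\<kappa> j) \<in> (\<lambda>k. s (Suc k)) ` T - {1}"
      using range[of "\<kappa> j"] nonint[OF j] by simp
  qed
  then have "card ((\<lambda>j. s (\<kappa> j)) ` {1..d+1}) \<le> card ((\<lambda>k. s (Suc k)) ` T - {1})"
    using fT by (intro card_mono) auto
  then have "d + 1 \<le> card ((\<lambda>k. s (Suc k)) ` T - {1})"
    by (simp only: card_image[OF inj]) simp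
  \<comment> \<open>The total \<open>s n\<close> is 1, not 0, so it is among the values after a
    nonzero term; removing it leaves room for at most \<open>d\<close> values.\<close>
  moreover have "1 \<in> (\<lambda>k. s (Suc k)) ` T"
    using range[of n] sum1 by (auto simp: s_def)
  then have "card ((\<lambda>k. s (Suc k)) ` T - {1}) < card ((\<lambda>k. s (Suc k)) ` T)"
    using fT by (intro psubset_card_mono) auto
  moreover have "card ((\<lambda>k. s (Suc k)) ` T) \<le> d + 1"
    using card_image_le[OF fT, of "\<lambda>k. s (Suc k)"] supp by (simp add: T_def)
  ultimately show False by linarith
qed

text \<open>If no \<epsilon> works, there are points \<open>X n\<close> that come within
  \<open>1 / (n + 1)\<close>, measured by \<open>G\<close>, of every member of the family. A limit
  point of them would be at distance 0 from every member, against \<open>sep\<close>.\<close>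

lemma uniform_separation:
  fixes G :: "'a::metric_space \<Rightarrow> 'a \<Rightarrow> real"
  assumes S: "compact S"
    and \<F>: "\<And>C. C \<in> \<F> \<Longrightarrow> compact C \<and> C \<subseteq> S"
    and cont: "\<And>x. x \<in> S \<Longrightarrow> continuous_on S (G x)"
    and zero: "\<And>x. x \<in> S \<Longrightarrow> G x x = 0"
    and tri: "\<And>x y z. x \<in> S \<Longrightarrow> y \<in> S \<Longrightarrow> z \<in> S \<Longrightarrow> G x z \<le> G x y + G y z"
    and sep: "\<And>x. x \<in> S \<Longrightarrow> \<exists>C\<in>\<F>. \<forall>z\<in>C. 0 < G x z"
  shows "\<exists>\<epsilon>>0. \<forall>x\<in>S. \<exists>C\<in>\<F>. \<forall>z\<in>C. \<epsilon> \<le> G x z"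
proof (rule ccontr)
  assume "\<not> ?thesis"
  then have "\<exists>x\<in>S. \<forall>C\<in>\<F>. \<exists>z\<in>C. G x z < inverse (real (Suc n))" for n
    by (auto simp: not_le)
  then obtain X where X: "\<And>n. X n \<in> S" "\<And>n C. C \<in> \<F> \<Longrightarrow> \<exists>z\<in>C. G (X n) z < inverse (real (Suc n))"
    by metis
  obtain x r where x: "x \<in> S" "strict_mono (r :: nat \<Rightarrow> nat)" "(X \<circ> r) \<longlonglongrightarrow> x"
    using S X(1) unfolding compact_def by blast
  \<comment> \<open>One set \<open>C\<close>, picked at the limit \<open>x\<close>, is tested
    against the whole sequence. Its positive minimum \<open>G x z0\<close> is bounded, via the
    triangle inequality through \<open>X (r n)\<close>, by a quantity tending to 0.\<close>
  obtain C where C: "C \<in> \<F>" "\<forall>z\<in>C. 0 < G x z" using sep[OF x(1)] by blast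
  have "C \<noteq> {}" using X(2)[OF C(1)] by blast
  then obtain z0 where z0: "z0 \<in> C" "\<And>z. z \<in> C \<Longrightarrow> G x z0 \<le> G x z"
    using continuous_attains_inf[of C "G x"] \<F>[OF C(1)] continuous_on_subset[OF cont[OF x(1)]] by blast
  have "(\<lambda>n. G x ((X \<circ> r) n)) \<longlonglongrightarrow> G x x"
    using continuous_on_tendsto_compose[OF cont[OF x(1)] x(3,1)] X(1) by auto
  moreover have "(\<lambda>n. inverse (real (Suc (r n)))) \<longlonglongrightarrow> 0"
    using LIMSEQ_subseq_LIMSEQ[OF LIMSEQ_inverse_real_of_nat x(2)] by (simp add: o_def)
  ultimately have "(\<lambda>n. G x ((X \<circ> r) n) + inverse (real (Suc (r n)))) \<longlonglongrightarrow> G x x + 0"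
    by (rule tendsto_add)
  moreover have "G x z0 \<le> G x ((X \<circ> r) n) + inverse (real (Suc (r n)))" for n
  proof -
    obtain z where z: "z \<in> C" "G (X (r n)) z < inverse (real (Suc (r n)))"
      using X(2)[OF C(1), of "r n"] by blast
    then have "G x z \<le> G x (X (r n)) + G (X (r n)) z"
      using tri x(1) X(1) \<F>[OF C(1)] by blast
    then show ?thesis using z z0(2)[OF z(1)] by simp
  qed
  ultimately have "G x z0 \<le> G x x + 0" by (intro LIMSEQ_le_const) auto
  then show False using zero[OF x(1)] C(2) z0(1) by force
qed

section \<open>The theorem in terms of finitely many coordinate functions\<close>

text \<open>The functions \<open>a k\<close> stand in for the map to the polyhedron: they will be
  its barycentric coordinates in a fixed order of the vertices, so that agreement in all of them
  means equal images.\<close>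

lemma colourful_coincidence:
  fixes S :: "'a::euclidean_space set" and a :: "nat \<Rightarrow> 'a \<Rightarrow> real"
  assumes S: "compact S" "convex S" "S \<noteq> {}"
    and F: "\<And>i. i \<in> {1..d+1} \<Longrightarrow> finite (F i)"
    and ne: "\<And>i. i \<in> {1..d+1} \<Longrightarrow> F i \<noteq> {}"
    and C: "\<And>i C. i \<in> {1..d+1} \<Longrightarrow> C \<in> F i \<Longrightarrow> compact C \<and> convex C \<and> C \<subseteq> S"
    and rainbow: "\<And>c. c \<in> Pi\<^sub>E {1..d+1} F \<Longrightarrow> (\<Inter>i\<in>{1..d+1}. c i) \<noteq> {}"
    and a: "\<And>k. k < n \<Longrightarrow> continuous_on S (a k)"
    and sum1: "\<And>x. x \<in> S \<Longrightarrow> (\<Sum>k<n. a k x) = 1"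
    and supp: "\<And>x. x \<in> S \<Longrightarrow> card {k. k < n \<and> a k x \<noteq> 0} \<le> d + 1"
  shows "\<exists>x\<in>S. \<exists>i\<in>{1..d+1}. \<forall>C\<in>F i. \<exists>z\<in>C. \<forall>k<n. a k z = a k x"
proof (rule ccontr)
  assume neg: "\<not> ?thesis"
  define s where "s = (\<lambda>k x. \<Sum>l<k. a l x)"
  \<comment> \<open>The l1 distance between the vectors of partial sums. It is positive as soon as
    two points differ in some \<open>a k\<close>, so the negated claim supplies the separation
    needed for \<open>uniform_separation\<close>.\<close>
  define G where "G = (\<lambda>x z. \<Sum>k\<le>n. \<bar>s k x - s k z\<bar>)"
  have conts: "continuous_on S (s k)" if "k \<le> n" for k
    unfolding s_def using that a by (intro continuous_intros) auto
  have Gpos: "0 < G x z" if "k < n" "a k z \<noteq> a k x" for k x z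
  proof (rule ccontr)
    assume "\<not> 0 < G x z"
    then have "G x z = 0" unfolding G_def by (simp add: sum_nonneg order_antisym)
    then have "\<forall>k\<le>n. s k x = s k z" unfolding G_def by (simp add: sum_nonneg_eq_0_iff)
    then have "s k x = s k z" "s (Suc k) x = s (Suc k) z" using that by auto
    then show False using that by (simp add: s_def)
  qed
  have "\<exists>\<epsilon>>0. \<forall>x\<in>S. \<exists>C\<in>F i. \<forall>z\<in>C. \<epsilon> \<le> G x z" if i: "i \<in> {1..d+1}" for i
  proof (rule uniform_separation[OF S(1)])
    show "\<And>C. C \<in> F i \<Longrightarrow> compact C \<and> C \<subseteq> S" using C i by blast
    show "continuous_on S (G x)" for x
      unfolding G_def using conts by (intro continuous_intros) auto
    show "G x x = 0" for x by (simp add: G_def)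
    show "G x z \<le> G x y + G y z" for x y z
      unfolding G_def sum.distrib[symmetric] by (intro sum_mono) auto
    show "\<exists>C\<in>F i. \<forall>z\<in>C. 0 < G x z" if "x \<in> S" for x
      using neg that i Gpos by meson
  qed
  then obtain \<epsilon> where \<epsilon>: "\<And>i. i \<in> {1..d+1} \<Longrightarrow> 0 < \<epsilon> i \<and> (\<forall>x\<in>S. \<exists>C\<in>F i. \<forall>z\<in>C. \<epsilon> i \<le> G x z)"
    by metis
  define \<delta> where "\<delta> = Min (\<epsilon> ` {1..d+1})"
  have \<delta>: "0 < \<delta>" "\<And>i. i \<in> {1..d+1} \<Longrightarrow> \<delta> \<le> \<epsilon> i"
    unfolding \<delta>_def using \<epsilon> by auto
  \<comment> \<open>Equal floors of \<open>\<theta>\<close> force each of the \<open>n + 1\<close>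
    partial sums to agree up to \<open>1 / N\<close>, so \<open>G\<close> is at most
    \<open>(n + 1) / N\<close>; this has to be below \<open>\<delta>\<close>, the scale valid for
    all colours.\<close>
  obtain N :: nat where N: "real (n + 1) / \<delta> < real N" using reals_Archimedean2 by blast
  have N0: "0 < real N" using N \<delta>(1) by (smt (verit) divide_nonneg_pos of_nat_0_le_iff)
  define \<theta> where "\<theta> = (\<lambda>j k x. N * s k x - real j / (real d + 2))"
  \<comment> \<open>The code of the piece containing \<open>x\<close>. It is restricted to
    \<open>{..n}\<close> so that equal floors at these indices give equal codes.\<close>
  define \<kappa> where "\<kappa> = (\<lambda>j x. \<lambda>k\<in>{..n}. \<lfloor>\<theta> j k x\<rfloor>)"
  \<comment> \<open>The sine factors vanish exactly where some \<open>\<theta> j k\<close> is an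
    integer, that is, where a floor may jump.\<close>
  define u where "u = (\<lambda>j x. \<Prod>k\<le>n. \<bar>sin (\<theta> j k x * pi)\<bar>)"
  have u0: "u j x \<noteq> 0 \<longleftrightarrow> (\<forall>k\<le>n. \<theta> j k x \<notin> \<int>)" for j x
    unfolding u_def by (auto simp: sin_times_pi_eq_0)
  \<comment> \<open>A label for every code \<open>\<iota>\<close>. If no point of \<open>S\<close>
    has code \<open>\<iota>\<close>, any member of \<open>F j\<close> will do; otherwise take a
    member at distance at least \<open>\<epsilon> j\<close> from one point of the piece, which is
    too far to meet the piece.\<close>
  have "\<exists>C\<in>F j. \<forall>z\<in>C. \<kappa> j z \<noteq> \<iota>" if j: "j \<in> {1..d+1}" for j \<iota>
  proof (cases "\<exists>x\<in>S. \<kappa> j x = \<iota>")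
    case False
    then show ?thesis using C j ne[OF j] by blast
  next
    case True
    then obtain x where x: "x \<in> S" "\<kappa> j x = \<iota>" by blast
    obtain C' where C': "C' \<in> F j" "\<forall>z\<in>C'. \<epsilon> j \<le> G x z" using \<epsilon>[OF j] x(1) by blast
    have "\<kappa> j z \<noteq> \<iota>" if z: "z \<in> C'" for z
    proof
      assume eq: "\<kappa> j z = \<iota>"
      have "\<bar>s k x - s k z\<bar> \<le> 1 / N" if k: "k \<le> n" for k
      proof -
        have "\<lfloor>\<theta> j k x\<rfloor> = \<lfloor>\<theta> j k z\<rfloor>"
          using fun_cong[OF trans[OF x(2) eq[symmetric]], of k] k by (simp add: \<kappa>_def)
        then have "\<bar>\<theta> j k x - \<theta> j k z\<bar> \<le> 1" by linarith
        then have "N * \<bar>s k x - s k z\<bar> \<le> 1"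
          using N0 by (simp add: \<theta>_def abs_mult flip: right_diff_distrib)
        then show ?thesis using N0 by (simp add: field_simps)
      qed
      then have "G x z \<le> (\<Sum>k\<le>n. 1 / real N)"
        unfolding G_def by (intro sum_mono) auto
      also have "\<dots> = real (n + 1) / N" by simp
      also have "\<dots> < \<delta>" using N N0 \<delta>(1) by (simp add: field_simps)
      finally show False using C'(2) z \<delta>(2)[OF j] by fastforce
    qed
    then show ?thesis using C'(1) by blast
  qed
  then obtain A where A: "\<And>j \<iota>. j \<in> {1..d+1} \<Longrightarrow> A j \<iota> \<in> F j \<and> (\<forall>z\<in>A j \<iota>. \<kappa> j z \<noteq> \<iota>)"
    by metis
  \<comment> \<open>Each point has one code and hence one label per colour, so at most one set of
    each colour has positive weight there.\<close>
  define w where "w = (\<lambda>j C x. if A j (\<kappa> j x) = C then u j x else 0)"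
  have "\<exists>x\<in>S. \<exists>i\<in>{1..d+1}. \<exists>C\<in>F i. 0 < w i C x \<and> x \<in> C"
  proof (rule colourful_fixed_point[OF S])
    show "S \<inter> (\<Inter>i\<in>{1..d+1}. c i) \<noteq> {}" if c: "c \<in> Pi\<^sub>E {1..d+1} F" for c
    proof -
      have "c 1 \<subseteq> S" using C[of 1 "c 1"] PiE_mem[OF c, of 1] by simp
      then show ?thesis using rainbow[OF c] by fastforce
    qed
    show "continuous_on S (w j C)" if "j \<in> {1..d+1}" for j C
      unfolding w_def
    proof (rule continuous_on_if_locally_constant)
      show "continuous_on S (u j)"
        unfolding u_def \<theta>_def using conts by (intro continuous_intros) auto
      fix x assume x: "x \<in> S" "u j x \<noteq> 0"
      have "\<forall>\<^sub>F z in at x within S. \<lfloor>\<theta> j k z\<rfloor> = \<lfloor>\<theta> j k x\<rfloor>" if k: "k \<in> {..n}" for k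
      proof (rule eventually_floor_eq)
        have "continuous_on S (\<theta> j k)"
          unfolding \<theta>_def using conts k by (intro continuous_intros) auto
        then show "(\<theta> j k \<longlongrightarrow> \<theta> j k x) (at x within S)" using x by (simp add: continuous_on_def)
        show "\<theta> j k x \<notin> \<int>" using x(2) k u0 by auto
      qed
      then have "\<forall>\<^sub>F z in at x within S. \<forall>k\<in>{..n}. \<lfloor>\<theta> j k z\<rfloor> = \<lfloor>\<theta> j k x\<rfloor>"
        by (intro eventually_ball_finite) auto
      then show "\<forall>\<^sub>F z in at x within S. (A j (\<kappa> j z) = C) = (A j (\<kappa> j x) = C)"
      proof (rule eventually_mono)
        fix z assume "\<forall>k\<in>{..n}. \<lfloor>\<theta> j k z\<rfloor> = \<lfloor>\<theta> j k x\<rfloor>"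
        then have "\<kappa> j z = \<kappa> j x" unfolding \<kappa>_def by (intro restrict_ext) auto
        then show "(A j (\<kappa> j z) = C) = (A j (\<kappa> j x) = C)" by simp
      qed
    qed
    have unn: "0 \<le> u j x" for j x unfolding u_def by (intro prod_nonneg) auto
    then show "0 \<le> w j C x" for j C x by (simp add: w_def)
    show "C = C'" if "0 < w j C x" "0 < w j C' x" for j C C' x
      using that by (auto simp: w_def split: if_splits)
    show "\<exists>j\<in>{1..d+1}. \<exists>C\<in>F j. 0 < w j C x" if x: "x \<in> S" for x
    proof -
      obtain j where j: "j \<in> {1..d+1}" "\<forall>k\<le>n. \<theta> j k x \<notin> \<int>"
        using partial_sums_avoid_residue[OF sum1[OF x] supp[OF x], of N]
        unfolding \<theta>_def s_def by blast
      then have "0 < w j (A j (\<kappa> j x)) x" using u0[of j x] unn[of j x] by (simp add: w_def)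
      then show ?thesis using j(1) A by blast
    qed
  qed (use F ne C in auto)
  then obtain x i C where "i \<in> {1..d+1}" "C \<in> F i" "0 < w i C x" "x \<in> C" by blast
  \<comment> \<open>Positive weight forces \<open>C\<close> to be the label of the piece of
    \<open>x\<close>, and a label contains no point of its piece.\<close>
  then show False using A[of i "\<kappa> i x"] by (auto simp: w_def split: if_splits)
qed

section \<open>From the polyhedron to finitely many coordinates\<close>

text \<open>In the coherent topology, continuity of a coordinate can be tested on each closed
  simplex, where it is a projection of the product.\<close>

lemma continuous_on_barycentric_coordinate:
  assumes "continuous_map euclidean (polyhedron_space K) f"
  shows "continuous_on UNIV (\<lambda>x. f x v)"
proof -
  have "continuous_map (polyhedron_space K) euclideanreal (\<lambda>y. y v)"
    unfolding continuous_map_def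
  proof (intro conjI allI impI)
    fix U :: "real set" assume "openin euclidean U"
    then have U: "open U" by simp
    show "openin (polyhedron_space K) {y \<in> topspace (polyhedron_space K). y v \<in> U}"
      unfolding openin_polyhedron_space
    proof (intro conjI ballI)
      fix \<sigma> assume \<sigma>: "\<sigma> \<in> K"
      have "continuous_on (closed_simplex \<sigma>) (\<lambda>y::_ \<Rightarrow> real. y v)"
        by (rule continuous_on_subset[OF continuous_on_product_coordinates]) simp
      then have "openin (top_of_set (closed_simplex \<sigma>)) (closed_simplex \<sigma> \<inter> (\<lambda>y. y v) -` U)"
        using U by (rule continuous_openin_preimage_gen)
      moreover have "{y \<in> topspace (polyhedron_space K). y v \<in> U} \<inter> closed_simplex \<sigma>
          = closed_simplex \<sigma> \<inter> (\<lambda>y. y v) -` U"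
        using \<sigma> by (auto simp: polyhedron_points_def)
      ultimately show "openin (top_of_set (closed_simplex \<sigma>))
          ({y \<in> topspace (polyhedron_space K). y v \<in> U} \<inter> closed_simplex \<sigma>)"
        by simp
    qed auto
  qed auto
  then have "continuous_map euclidean euclideanreal ((\<lambda>y. y v) \<circ> f)"
    using assms by (rule continuous_map_compose[rotated])
  then show ?thesis by (simp add: o_def)
qed

text \<open>The sets \<open>B v\<close> are the preimages of the open stars of the vertices, so
  finitely many of them cover \<open>S\<close>. A simplex whose closed simplex contains
  \<open>f x\<close> must contain one of these finitely many vertices, and local finiteness bounds
  the number of such simplices.\<close>

lemma compact_image_in_finite_subcomplex:
  assumes lf: "locally_finite_complex K" and fin: "\<And>\<sigma>. \<sigma> \<in> K \<Longrightarrow> finite \<sigma>"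
    and f: "continuous_map euclidean (polyhedron_space K) f" and S: "compact S"
  obtains V where "finite V" "\<And>x \<sigma>. x \<in> S \<Longrightarrow> \<sigma> \<in> K \<Longrightarrow> f x \<in> closed_simplex \<sigma> \<Longrightarrow> \<sigma> \<subseteq> V"
proof -
  define B where "B = (\<lambda>v. {x. f x v \<noteq> 0})"
  have "open (B v)" for v
  proof -
    have "open ((\<lambda>x. f x v) -` (- {0}))"
      using continuous_on_barycentric_coordinate[OF f] by (intro open_vimage) auto
    then show ?thesis by (simp add: B_def vimage_def)
  qed
  moreover have "S \<subseteq> (\<Union>v\<in>\<Union>K. B v)"
  proof
    fix x assume "x \<in> S"
    have "f x \<in> polyhedron_points K"
      using continuous_map_image_subset_topspace[OF f] by auto
    then obtain \<sigma> where \<sigma>: "\<sigma> \<in> K" "f x \<in> closed_simplex \<sigma>" by (auto simp: polyhedron_points_def)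
    then have "(\<Sum>v\<in>\<sigma>. f x v) \<noteq> 0" by (simp add: closed_simplex_def)
    then obtain v where "v \<in> \<sigma>" "f x v \<noteq> 0" by (meson sum.neutral)
    then show "x \<in> (\<Union>v\<in>\<Union>K. B v)" using \<sigma> by (auto simp: B_def)
  qed
  ultimately obtain D where D: "D \<subseteq> \<Union>K" "finite D" "S \<subseteq> (\<Union>v\<in>D. B v)"
    using compactE_image[OF S, of "\<Union>K" B] by blast
  show ?thesis
  proof
    show "finite (\<Union>v\<in>D. \<Union>{\<sigma>\<in>K. v \<in> \<sigma>})"
      using D lf fin unfolding locally_finite_complex_def by blast
    fix x \<sigma> assume x: "x \<in> S" "\<sigma> \<in> K" "f x \<in> closed_simplex \<sigma>"
    then obtain v where v: "v \<in> D" "f x v \<noteq> 0" using D(3) by (auto simp: B_def)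
    then have "v \<in> \<sigma>" using x(3) by (auto simp: closed_simplex_def)
    then show "\<sigma> \<subseteq> (\<Union>v\<in>D. \<Union>{\<sigma>\<in>K. v \<in> \<sigma>})" using v x(2) by blast
  qed
qed

theorem theorem1:
  fixes d :: nat
    and F :: "nat \<Rightarrow> (real ^ 'm) set set"
    and Y :: "'v set set"
    and f :: "real ^ 'm \<Rightarrow> ('v \<Rightarrow> real)"
  assumes "d \<ge> 1" and "CARD('m) > d"
    and "\<And>i. i \<in> {1..d+1} \<Longrightarrow> finite (F i)"
    and "\<And>i C. i \<in> {1..d+1} \<Longrightarrow> C \<in> F i \<Longrightarrow> compact C \<and> convex C"
    and "abstract_simplicial_complex Y" and "locally_finite_complex Y" and "has_dimension Y d"
    and "\<And>C. (\<And>i. i \<in> {1..d+1} \<Longrightarrow> C i \<in> F i) \<Longrightarrow> (\<Inter>i\<in>{1..d+1}. C i) \<noteq> {}"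
    and "continuous_map euclidean (polyhedron_space Y) f"
  shows "\<exists>y \<in> topspace (polyhedron_space Y). \<exists>i\<in>{1..d+1}. \<forall>C \<in> F i. f -` {y} \<inter> C \<noteq> {}"
proof (cases "\<exists>i\<in>{1..d+1}. F i = {}")
  \<comment> \<open>With an empty family the claim is vacuous for its index, and only some point of
    the polyhedron is required.\<close>
  case True
  have "f 0 \<in> topspace (polyhedron_space Y)"
    using continuous_map_image_subset_topspace[OF assms(9)] by auto
  then show ?thesis using True by blast
next
  case ne: False
  define S where "S = convex hull (\<Union>i\<in>{1..d+1}. \<Union>(F i))"
  have S: "compact S" "convex S"
    unfolding S_def using assms(3,4) by (auto intro!: compact_convex_hull compact_UN compact_Union)
  have sub: "C \<subseteq> S" if "i \<in> {1..d+1}" "C \<in> F i" for i C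
    using that hull_subset[of "\<Union>i\<in>{1..d+1}. \<Union>(F i)" convex] unfolding S_def by blast
  have rainbow: "(\<Inter>i\<in>{1..d+1}. c i) \<noteq> {}" if "c \<in> Pi\<^sub>E {1..d+1} F" for c
    using that assms(8)[of c] by blast
  obtain c where c: "c \<in> Pi\<^sub>E {1..d+1} F" using ne by (metis PiE_eq_empty_iff ex_in_conv)
  then have "c 1 \<subseteq> S" using sub[of 1 "c 1"] PiE_mem[OF c, of 1] by simp
  then have "S \<noteq> {}" using rainbow[OF c] by fastforce
  have finY: "finite \<sigma>" if "\<sigma> \<in> Y" for \<sigma>
    using assms(5) that by (simp add: abstract_simplicial_complex_def)
  have inY: "\<exists>\<sigma>\<in>Y. f x \<in> closed_simplex \<sigma>" for x
    using continuous_map_image_subset_topspace[OF assms(9)] by (auto simp: polyhedron_points_def)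
  obtain V where V: "finite V" "\<And>x \<sigma>. x \<in> S \<Longrightarrow> \<sigma> \<in> Y \<Longrightarrow> f x \<in> closed_simplex \<sigma> \<Longrightarrow> \<sigma> \<subseteq> V"
    using compact_image_in_finite_subcomplex[OF assms(6) finY assms(9) S(1)] by blast
  \<comment> \<open>This enumeration fixes the order of the vertices in which the partial sums are
    formed.\<close>
  obtain h where h: "bij_betw h {..<card V} V"
    using ex_bij_betw_nat_finite[OF V(1)] by (auto simp: atLeast0LessThan)
  have "\<exists>x\<in>S. \<exists>i\<in>{1..d+1}. \<forall>C\<in>F i. \<exists>z\<in>C. \<forall>k<card V. f z (h k) = f x (h k)"
  proof (rule colourful_coincidence[OF S \<open>S \<noteq> {}\<close>])
    show "continuous_on S (\<lambda>x. f x (h k))" for k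
      using continuous_on_barycentric_coordinate[OF assms(9)] continuous_on_subset by blast
    fix x assume x: "x \<in> S"
    obtain \<sigma> where \<sigma>: "\<sigma> \<in> Y" "f x \<in> closed_simplex \<sigma>" using inY by blast
    have "(\<Sum>k<card V. f x (h k)) = (\<Sum>v\<in>V. f x v)" by (rule sum.reindex_bij_betw[OF h])
    also have "\<dots> = (\<Sum>v\<in>\<sigma>. f x v)"
      using V(1) V(2)[OF x \<sigma>] \<sigma>(2) by (intro sum.mono_neutral_right) (auto simp: closed_simplex_def)
    also have "\<dots> = 1" using \<sigma>(2) by (simp add: closed_simplex_def)
    finally show "(\<Sum>k<card V. f x (h k)) = 1" .
    have "card {k. k < card V \<and> f x (h k) \<noteq> 0} \<le> card \<sigma>"
    proof (rule card_inj_on_le)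
      show "inj_on h {k. k < card V \<and> f x (h k) \<noteq> 0}"
        using h by (auto simp: bij_betw_def intro: inj_on_subset)
      show "h ` {k. k < card V \<and> f x (h k) \<noteq> 0} \<subseteq> \<sigma>"
        using \<sigma>(2) by (auto simp: closed_simplex_def)
    qed (rule finY[OF \<sigma>(1)])
    also have "\<dots> \<le> d + 1" using assms(7) \<sigma>(1) by (simp add: has_dimension_def)
    finally show "card {k. k < card V \<and> f x (h k) \<noteq> 0} \<le> d + 1" .
  qed (use assms(3,4) ne sub rainbow in auto)
  then obtain x i where x: "x \<in> S" and i: "i \<in> {1..d+1}"
    and eq: "\<And>C. C \<in> F i \<Longrightarrow> \<exists>z\<in>C. \<forall>k<card V. f z (h k) = f x (h k)" by blast
  have "f -` {f x} \<inter> C \<noteq> {}" if C: "C \<in> F i" for C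
  proof -
    obtain z where z: "z \<in> C" "\<forall>k<card V. f z (h k) = f x (h k)" using eq[OF C] by blast
    then have zS: "z \<in> S" using sub[OF i C] by blast
    \<comment> \<open>Coordinates at vertices outside \<open>V\<close> vanish on all of
      \<open>S\<close>, so agreement on \<open>V\<close> gives \<open>f z = f x\<close> as
      functions.\<close>
    have outside: "f y v = 0" if "y \<in> S" "v \<notin> V" for y v
      using inY[of y] V(2)[OF that(1)] that(2) by (fastforce simp: closed_simplex_def)
    have "f z v = f x v" for v
    proof (cases "v \<in> V")
      case True
      then obtain k where "k < card V" "v = h k" using h by (auto simp: bij_betw_def)
      then show ?thesis using z(2) by blast
    next
      case False
      then show ?thesis using outside[OF x] outside[OF zS] by simp
    qed
    then show ?thesis using z(1) by blast
  qed
  moreover have "f x \<in> topspace (polyhedron_space Y)"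
    using inY[of x] by (auto simp: polyhedron_points_def)
  ultimately show ?thesis using i by blast
qed

end
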